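(* One has $$L(K_0)=\left\{\begin{pmatrix}p&c\\ B&\beta\end{pmatrix}\ \Big|\ \operatorname{tr}B=0,\ |\beta|^2+(p\cdot\beta)^2-p\cdot\beta<0\right\}.$$ Moreover, given any $\xi\in L(K_0)$, there exist a rank-one matrix $$\eta=\begin{pmatrix}q&b\\ \frac1b\gamma\otimes q&\gamma\end{pmatrix}$$ with $q,\gamma\in\mathbb{R}^n$, $|q|=1$, $\gamma\cdot q=0$, $b\in\mathbb{R}$, $b\ne0$, and two numbers $t_-<0<t_+$ such that $\xi+t_\pm\eta\in K_0$, where $|b|>0$ can be taken arbitrarily small (i.e. for every $\epsilon>0$ such $\eta$ and $t_\pm$ exist with $0<|b|<\epsilon$).
   Context: Matrices in $\mathbf{M}^{(1+n)\times(n+1)}$ (real $(1+n)\times(n+1)$ matrices) are written in block form $\begin{pmatrix}p&c\\ B&\beta\end{pmatrix}$ with $p\in\mathbb{R}^n$ (a row), $c\in\mathbb{R}$, $B\in\mathbf{M}^{n\times n}$, $\beta\in\mathbb{R}^n$ (a column). $\gamma\otimes q$ denotes the $n\times n$ matrix $(\gamma^iq_j)$. Let $\sigma(p)=\frac{p}{1+|p|^2}$ and $$K_0=\left\{\begin{pmatrix}p&c\\ B&\sigma(p)\end{pmatrix}\ \Big|\ p\in\mathbb{R}^n,\ c\in\mathbb{R},\ B\in\mathbf{M}^{n\times n},\ \operatorname{tr}B=0\right\}.$$ $L(K_0)$ is the set of all $\xi\in\mathbf{M}^{(1+n)\times(n+1)}\setminus K_0$ such that $\xi=\lambda\xi_1+(1-\lambda)\xi_2$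 for some $\lambda\in(0,1)$ and $\xi_1,\xi_2\in K_0$ with $\operatorname{rank}(\xi_1-\xi_2)=1$. *)

theory Defs
  imports "HOL-Analysis.Analysis"
begin

text \<open>
  The space of real \<open>(1+n) \<times> (n+1)\<close> matrices; \<open>n\<close> is the cardinality of the finite type \<open>'n\<close>.
  Rows are indexed by \<open>unit + 'n\<close> (the single row first), columns by \<open>'n + unit\<close>
  (the single column last), so that the block form below is literal.
\<close>

type_synonym 'n block_matrix = "real ^ ('n + unit) ^ (unit + 'n)"

definition block ::
    "real ^ 'n \<Rightarrow> real \<Rightarrow> real ^ 'n ^ 'n \<Rightarrow> real ^ 'n \<Rightarrow> ('n::finite) block_matrix"
  where "block p c B \<beta> = (\<chi> i j. case i of
           Inl _ \<Rightarrow> (case j of Inl k \<Rightarrow> p $ k | Inr _ \<Rightarrow> c)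
         | Inr l \<Rightarrow> (case j of Inl k \<Rightarrow> B $ l $ k | Inr _ \<Rightarrow> \<beta> $ l))"

definition tensor :: "real ^ 'n \<Rightarrow> real ^ 'n \<Rightarrow> real ^ 'n ^ ('n::finite)"
  where "tensor \<gamma> q = (\<chi> i j. \<gamma> $ i * q $ j)"

definition sigma_map :: "real ^ 'n \<Rightarrow> real ^ ('n::finite)"
  where "sigma_map p = (1 / (1 + (norm p)\<^sup>2)) *\<^sub>R p"

definition K0 :: "('n::finite) block_matrix set"
  where "K0 = {block p c B (sigma_map p) | p c B. trace B = 0}"

definition L_set :: "('n::finite) block_matrix set \<Rightarrow> 'n block_matrix set"
  where "L_set K = {\<xi>. \<xi> \<notin> K \<and>
           (\<exists>\<mu>\<in>{0<..<1}. \<exists>\<xi>\<^sub>1\<in>K. \<exists>\<xi>\<^sub>2\<in>K.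
              rank (\<xi>\<^sub>1 - \<xi>\<^sub>2) = 1 \<and> \<xi> = \<mu> *\<^sub>R \<xi>\<^sub>1 + (1 - \<mu>) *\<^sub>R \<xi>\<^sub>2)}"

end

theory Submission
  imports Defs "HOL-Library.Quadratic_Discriminant"
begin

text \<open>
  Write \<open>F(p, \<beta>) = |\<beta>|\<^sup>2 + (p \<bullet> \<beta>)\<^sup>2 - p \<bullet> \<beta>\<close> and \<open>s = p \<bullet> \<beta>\<close>. Everything rests on a description
  of the nonlinear constraint that does not mention \<open>|p|\<close>: \<open>\<beta> = \<sigma>(p)\<close> holds if and only if
  \<open>\<beta> = (1 - s) p\<close> (lemma \<open>eq_sigma_map_iff\<close>). In particular \<open>F = 0\<close> there. Geometrically,
  \<open>(\<beta>, s)\<close> runs over the sphere \<open>|\<beta>|\<^sup>2 + s\<^sup>2 = s\<close> without the pole \<open>(0, 1)\<close>, and \<open>p\<close> is the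
  stereographic projection of \<open>(\<beta>, s)\<close> from that pole.

  Let two points of \<open>K\<^sub>0\<close> differ by a rank-one matrix. The vanishing \<open>2 \<times> 2\<close> minors and \<open>tr B = 0\<close>
  give \<open>(p\<^sub>1 - p\<^sub>2) \<bullet> (\<beta>\<^sub>1 - \<beta>\<^sub>2) = 0\<close>, so \<open>s\<close> is affine along the segment between them. Hence \<open>F\<close> is
  convex along it, and strictly convex when \<open>p\<^sub>1 \<noteq> p\<^sub>2\<close>; as it vanishes at both ends, it is negative
  in between (lemma \<open>defect_neg_between\<close>).

  Conversely let \<open>F(p, \<beta>) < 0\<close> and put \<open>w = (1 - s) p - \<beta>\<close>, the error in the constraint, so that
  \<open>w \<bullet> \<beta> = -F\<close>. Let \<open>\<gamma>\<close> be the component of \<open>p\<close> orthogonal to \<open>w\<close>, and let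
  \<open>q = ((1 + |\<gamma>|\<^sup>2) / F) w\<close>. Then \<open>\<gamma> \<bullet> q = 0\<close> and \<open>q \<bullet> \<beta> + p \<bullet> \<gamma> = -1\<close>, so \<open>s\<close> becomes \<open>s - t\<close> at
  \<open>(p + t q, \<beta> + t \<gamma>)\<close>, and the error there is a multiple of \<open>w\<close> whose coefficient is a quadratic
  polynomial in \<open>t\<close>. Multiplied by \<open>F\<close> it is \<open>(1 + |\<gamma>|\<^sup>2) t\<^sup>2 + h t + F\<close> for some real \<open>h\<close>, which has
  one root of each sign because \<open>F < 0\<close> (lemma \<open>defect_neg_split\<close>). The number \<open>b\<close> does not enter
  this construction, so any nonzero value serves.
\<close>

section \<open>Rank-one matrices and the block form\<close>

lemma rank_eq_1_iff_outer:
  fixes A :: "real ^ 'm ^ 'k"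
  shows "rank A = 1 \<longleftrightarrow> A \<noteq> 0 \<and> (\<exists>x y. \<forall>i j. A $ i $ j = x i * y j)"
proof
  assume r: "rank A = 1"
  then have "A \<noteq> 0" by auto
  obtain Bs where Bs: "rows A \<subseteq> span Bs" "card Bs = dim (rows A)"
    using basis_exists[of "rows A"] by metis
  then obtain y where y: "rows A \<subseteq> span {y}"
    using r by (metis card_1_singletonE row_rank_def)
  have "\<exists>k. A $ i = k *\<^sub>R y" for i
  proof -
    have "A $ i \<in> rows A" by (auto simp: rows_def row_def vec_lambda_eta)
    then show ?thesis using y by (auto simp: span_singleton)
  qed
  then obtain x where "\<And>i. A $ i = x i *\<^sub>R y" by metis
  then have "\<forall>i j. A $ i $ j = x i * (\<lambda>j. y $ j) j" by simp
  then show "A \<noteq> 0 \<and> (\<exists>x y. \<forall>i j. A $ i $ j = x i * y j)"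
    using \<open>A \<noteq> 0\<close> by blast
next
  assume "A \<noteq> 0 \<and> (\<exists>x y. \<forall>i j. A $ i $ j = x i * y j)"
  then obtain x y where nz: "A \<noteq> 0" and xy: "\<And>i j. A $ i $ j = x i * y j" by blast
  have row: "row i A = x i *\<^sub>R (\<chi> j. y j)" for i
    by (simp add: row_def vec_eq_iff xy)
  have "rows A \<subseteq> span {\<chi> j. y j}"
    by (auto simp: rows_def row span_singleton)
  then have "dim (rows A) \<le> card {\<chi> j. y j}"
    by (intro dim_le_card) auto
  then have "rank A \<le> 1" by (simp add: row_rank_def)
  moreover have "rank A \<noteq> 0" using nz by (simp add: rank_eq_0)
  ultimately show "rank A = 1" by simp
qed

lemma rank_eq_1_scaleR:
  fixes A :: "real ^ 'm ^ 'k"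
  assumes "rank A = 1" "k \<noteq> 0"
  shows "rank (k *\<^sub>R A) = 1"
proof -
  obtain x y where "A \<noteq> 0" and xy: "\<And>i j. A $ i $ j = x i * y j"
    using assms(1) unfolding rank_eq_1_iff_outer by blast
  have "\<exists>x y. \<forall>i j. (k *\<^sub>R A) $ i $ j = x i * y j"
    by (rule exI[of _ "\<lambda>i. k * x i"], rule exI[of _ y]) (simp add: xy)
  moreover have "k *\<^sub>R A \<noteq> 0" using \<open>A \<noteq> 0\<close> assms(2) by simp
  ultimately show ?thesis unfolding rank_eq_1_iff_outer by blast
qed

lemma block_add: "block p c B \<beta> + block p' c' B' \<beta>' = block (p + p') (c + c') (B + B') (\<beta> + \<beta>')"
  by (simp add: block_def vec_eq_iff split: sum.split)

lemma block_diff: "block p c B \<beta> - block p' c' B' \<beta>' = block (p - p') (c - c') (B - B') (\<beta> - \<beta>')"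
  by (simp add: block_def vec_eq_iff split: sum.split)

lemma block_scaleR: "k *\<^sub>R block p c B \<beta> = block (k *\<^sub>R p) (k * c) (k *\<^sub>R B) (k *\<^sub>R \<beta>)"
  by (simp add: block_def vec_eq_iff split: sum.split)

lemma block_nth [simp]:
  "block p c B \<beta> $ Inl u $ Inl k = p $ k"
  "block p c B \<beta> $ Inl u $ Inr v = c"
  "block p c B \<beta> $ Inr l $ Inl k = B $ l $ k"
  "block p c B \<beta> $ Inr l $ Inr v = \<beta> $ l"
  by (simp_all add: block_def)

lemma block_eq_iff:
  "block p c B \<beta> = block p' c' B' \<beta>' \<longleftrightarrow> p = p' \<and> c = c' \<and> B = B' \<and> \<beta> = \<beta>'"
proof
  assume e: "block p c B \<beta> = block p' c' B' \<beta>'"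
  show "p = p' \<and> c = c' \<and> B = B' \<and> \<beta> = \<beta>'"
    unfolding vec_eq_iff using e by (metis block_nth)
qed simp

lemma trace_scaleR: "trace (k *\<^sub>R A) = k * trace (A :: real ^ 'n ^ 'n)"
  by (simp add: trace_def sum_distrib_left)

lemma trace_tensor: "trace (tensor \<gamma> q) = \<gamma> \<bullet> q"
  by (simp add: trace_def tensor_def inner_vec_def)

lemma rank_block_eq_1:
  assumes "q \<noteq> 0" "b \<noteq> 0"
  shows "rank (block q b ((1 / b) *\<^sub>R tensor \<gamma> q) \<gamma>) = 1"
  unfolding rank_eq_1_iff_outer
proof
  obtain k where "q $ k \<noteq> 0" using assms(1) by (auto simp: vec_eq_iff)
  then have "block q b ((1 / b) *\<^sub>R tensor \<gamma> q) \<gamma> $ Inl () $ Inl k \<noteq> 0" by simp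
  then show "block q b ((1 / b) *\<^sub>R tensor \<gamma> q) \<gamma> \<noteq> 0" by (metis zero_index)
  have "block q b ((1 / b) *\<^sub>R tensor \<gamma> q) \<gamma> $ i $ j =
      (case i of Inl _ \<Rightarrow> 1 | Inr l \<Rightarrow> \<gamma> $ l / b) * (case j of Inl k \<Rightarrow> q $ k | Inr _ \<Rightarrow> b)" for i j
    using assms(2) by (simp add: tensor_def split: sum.split)
  then show "\<exists>x y. \<forall>i j. block q b ((1 / b) *\<^sub>R tensor \<gamma> q) \<gamma> $ i $ j = x i * y j"
    by (intro exI allI)
qed

text \<open>The minors \<open>p\<^sub>k \<beta>\<^sub>k - c B\<^sub>k\<^sub>k\<close> vanish; their sum is \<open>p \<bullet> \<beta> - c tr B\<close>.\<close>

lemma rank_1_block_inner: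
  assumes "rank (block p c B \<beta>) = 1" "trace B = 0"
  shows "p \<bullet> \<beta> = 0"
proof -
  obtain x y where xy: "\<And>i j. block p c B \<beta> $ i $ j = x i * y j"
    using assms(1) unfolding rank_eq_1_iff_outer by blast
  have "p $ k * \<beta> $ k = c * B $ k $ k" for k
    using xy[of "Inl ()" "Inl k"] xy[of "Inl ()" "Inr ()"] xy[of "Inr k" "Inl k"]
      xy[of "Inr k" "Inr ()"] by simp
  then have "p \<bullet> \<beta> = c * trace B"
    by (simp add: inner_vec_def trace_def sum_distrib_left)
  then show ?thesis using assms(2) by simp
qed

lemma block_in_K0_iff: "block p c B \<beta> \<in> K0 \<longleftrightarrow> trace B = 0 \<and> \<beta> = sigma_map p"
  unfolding K0_def by (auto simp: block_eq_iff)

section \<open>The defect function\<close>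

text \<open>The function whose negativity describes \<open>L(K\<^sub>0)\<close>.\<close>

definition defect :: "real ^ 'n \<Rightarrow> real ^ 'n \<Rightarrow> real"
  where "defect p \<beta> = (norm \<beta>)\<^sup>2 + (p \<bullet> \<beta>)\<^sup>2 - p \<bullet> \<beta>"

lemma eq_sigma_map_iff: "\<beta> = sigma_map p \<longleftrightarrow> \<beta> = (1 - p \<bullet> \<beta>) *\<^sub>R p"
proof -
  have pos: "1 + (norm p)\<^sup>2 > 0" by (smt (verit) zero_le_power2)
  show ?thesis
  proof
    assume b: "\<beta> = sigma_map p"
    have "p \<bullet> \<beta> = (norm p)\<^sup>2 / (1 + (norm p)\<^sup>2)"
      by (simp add: b sigma_map_def power2_norm_eq_inner)
    then have "1 - p \<bullet> \<beta> = 1 / (1 + (norm p)\<^sup>2)"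
      using pos by (simp add: field_simps)
    then show "\<beta> = (1 - p \<bullet> \<beta>) *\<^sub>R p" by (simp add: b sigma_map_def)
  next
    assume b: "\<beta> = (1 - p \<bullet> \<beta>) *\<^sub>R p"
    have "p \<bullet> \<beta> = (1 - p \<bullet> \<beta>) * (norm p)\<^sup>2"
      by (metis b inner_scaleR_right power2_norm_eq_inner)
    then have "(1 - p \<bullet> \<beta>) * (1 + (norm p)\<^sup>2) = 1" by (simp add: algebra_simps)
    then have "1 - p \<bullet> \<beta> = 1 / (1 + (norm p)\<^sup>2)"
      using pos by (simp add: field_simps)
    then show "\<beta> = sigma_map p" using b by (simp add: sigma_map_def)
  qed
qed

lemma defect_sigma_map: "defect p (sigma_map p) = 0"
proof -
  define \<beta> where "\<beta> = sigma_map p"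
  then have "\<beta> = (1 - p \<bullet> \<beta>) *\<^sub>R p" using eq_sigma_map_iff by blast
  then have "\<beta> \<bullet> \<beta> = (1 - p \<bullet> \<beta>) * (p \<bullet> \<beta>)" by (metis inner_scaleR_left)
  then show ?thesis
    unfolding defect_def \<beta>_def[symmetric] power2_norm_eq_inner
    by (simp add: power2_eq_square algebra_simps)
qed

text \<open>On a line where \<open>p \<bullet> \<beta>\<close> is affine, \<open>defect\<close> is an exact quadratic with nonnegative leading
  coefficient.\<close>

lemma defect_convex_combination:
  assumes "(p1 - p2) \<bullet> (\<beta>1 - \<beta>2) = 0"
  shows "defect (\<mu> *\<^sub>R p1 + (1 - \<mu>) *\<^sub>R p2) (\<mu> *\<^sub>R \<beta>1 + (1 - \<mu>) *\<^sub>R \<beta>2) =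
    \<mu> * defect p1 \<beta>1 + (1 - \<mu>) * defect p2 \<beta>2
    - \<mu> * (1 - \<mu>) * ((norm (\<beta>1 - \<beta>2))\<^sup>2 + (p1 \<bullet> \<beta>1 - p2 \<bullet> \<beta>2)\<^sup>2)"
proof -
  have cross: "p1 \<bullet> \<beta>2 = p1 \<bullet> \<beta>1 + p2 \<bullet> \<beta>2 - p2 \<bullet> \<beta>1"
    using assms by (simp add: inner_diff_left inner_diff_right)
  have s: "(\<mu> *\<^sub>R p1 + (1 - \<mu>) *\<^sub>R p2) \<bullet> (\<mu> *\<^sub>R \<beta>1 + (1 - \<mu>) *\<^sub>R \<beta>2)
      = \<mu> * (p1 \<bullet> \<beta>1) + (1 - \<mu>) * (p2 \<bullet> \<beta>2)"
    by (simp add: inner_add_left inner_add_right cross) (simp add: algebra_simps)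
  show ?thesis
    unfolding defect_def s power2_norm_eq_inner
    by (simp add: inner_add_left inner_add_right inner_diff_left inner_diff_right
        inner_commute[of \<beta>2 \<beta>1] power2_eq_square) (simp add: algebra_simps)
qed

lemma defect_neg_between:
  assumes "p1 \<noteq> p2" "(p1 - p2) \<bullet> (sigma_map p1 - sigma_map p2) = 0" "0 < \<mu>" "\<mu> < 1"
  shows "defect (\<mu> *\<^sub>R p1 + (1 - \<mu>) *\<^sub>R p2)
           (\<mu> *\<^sub>R sigma_map p1 + (1 - \<mu>) *\<^sub>R sigma_map p2) < 0"
proof -
  let ?s1 = "p1 \<bullet> sigma_map p1" and ?s2 = "p2 \<bullet> sigma_map p2"
  let ?D = "(norm (sigma_map p1 - sigma_map p2))\<^sup>2 + (?s1 - ?s2)\<^sup>2"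
  have e1: "sigma_map p1 = (1 - ?s1) *\<^sub>R p1" and e2: "sigma_map p2 = (1 - ?s2) *\<^sub>R p2"
    using eq_sigma_map_iff by blast+
  have "\<not> (sigma_map p1 = sigma_map p2 \<and> ?s1 = ?s2)"
  proof
    assume eq: "sigma_map p1 = sigma_map p2 \<and> ?s1 = ?s2"
    (* s = 1 would force sigma_map p1 = 0 and hence s = 0 *)
    have "?s1 \<noteq> 1" using e1 by (metis diff_self inner_zero_right scale_zero_left zero_neq_one)
    moreover have "(1 - ?s1) *\<^sub>R p1 = (1 - ?s1) *\<^sub>R p2" using e1 e2 eq by metis
    ultimately show False using assms(1) by simp
  qed
  then have "?D > 0" by (auto simp: sum_power2_gt_zero_iff)
  then have "\<mu> * (1 - \<mu>) * ?D > 0" using assms(3,4) by simp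
  then show ?thesis
    unfolding defect_convex_combination[OF assms(2)] by (simp add: defect_sigma_map)
qed

section \<open>Splitting points of negative defect\<close>

lemma quadratic_roots_opposite_signs:
  fixes a h c :: real
  assumes "a > 0" "c < 0"
  shows "\<exists>x y. x < 0 \<and> 0 < y \<and> a * x\<^sup>2 + h * x + c = 0 \<and> a * y\<^sup>2 + h * y + c = 0"
proof -
  define r where "r = sqrt (discrim a h c)"
  have ac: "a * c < 0" using assms by (simp add: mult_pos_neg)
  then have d: "discrim a h c > h\<^sup>2" "discrim a h c \<ge> 0"
    using zero_le_power2[of h] unfolding discrim_def by linarith+
  have "r > \<bar>h\<bar>" unfolding r_def using d(1) by (metis real_sqrt_abs real_sqrt_less_iff)
  then have "(- h - r) / (2 * a) < 0" "0 < (- h + r) / (2 * a)"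
    using assms(1) by (auto simp: divide_less_0_iff zero_less_divide_iff)
  then show ?thesis
    using discriminant_iff[of a _ h c] assms(1) d(2) unfolding r_def by blast
qed

lemma defect_neg_split:
  assumes F: "defect p \<beta> < 0"
  shows "\<exists>q \<gamma> tm tp. norm q = 1 \<and> \<gamma> \<bullet> q = 0 \<and> tm < 0 \<and> 0 < tp \<and>
    \<beta> + tm *\<^sub>R \<gamma> = sigma_map (p + tm *\<^sub>R q) \<and> \<beta> + tp *\<^sub>R \<gamma> = sigma_map (p + tp *\<^sub>R q)"
proof -
  define F where "F = defect p \<beta>"
  define s where "s = p \<bullet> \<beta>"
  define w where "w = (1 - s) *\<^sub>R p - \<beta>"
  define g where "g = (p \<bullet> w) / (w \<bullet> w)"
  define \<gamma> where "\<gamma> = p - g *\<^sub>R w"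
  define N where "N = 1 + \<gamma> \<bullet> \<gamma>"
  define \<kappa> where "\<kappa> = N / F"
  define q where "q = \<kappa> *\<^sub>R w"
  define h where "h = N * (1 - s) + g * F"
  have F0: "F < 0" using F by (simp add: F_def)
  have N0: "N > 0" by (simp add: N_def add_pos_nonneg)
  have wb: "w \<bullet> \<beta> = - F"
    unfolding w_def F_def defect_def s_def power2_norm_eq_inner
    by (simp add: inner_diff_left power2_eq_square algebra_simps)
  then have w0: "w \<noteq> 0" using F0 by auto
  have gw: "\<gamma> \<bullet> w = 0" using w0 by (simp add: \<gamma>_def g_def inner_diff_left)
  then have gq: "\<gamma> \<bullet> q = 0" by (simp add: q_def)
  have pg: "p \<bullet> \<gamma> = \<gamma> \<bullet> \<gamma>"
    using gw by (simp add: \<gamma>_def inner_diff_left inner_commute inner_diff_right)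
  have qb: "q \<bullet> \<beta> = - N" using F0 by (simp add: q_def \<kappa>_def wb)
  have "q \<noteq> 0" using w0 N0 F0 by (simp add: q_def \<kappa>_def)
  then have q0: "norm q > 0" by simp
  (* every root t of the quadratic N t^2 + h t + F gives a point of the constraint *)
  have root: "\<beta> + t *\<^sub>R \<gamma> = sigma_map (p + t *\<^sub>R q)" if t: "N * t\<^sup>2 + h * t + F = 0" for t
  proof -
    have "(p + t *\<^sub>R q) \<bullet> (\<beta> + t *\<^sub>R \<gamma>) = s + t * (q \<bullet> \<beta> + p \<bullet> \<gamma>)"
      using gq by (simp add: inner_add_left inner_add_right s_def inner_commute algebra_simps)
    then have s': "1 - (p + t *\<^sub>R q) \<bullet> (\<beta> + t *\<^sub>R \<gamma>) = 1 - s + t"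
      by (simp add: qb pg N_def)
    have "(1 - s + t) *\<^sub>R (p + t *\<^sub>R q) - (\<beta> + t *\<^sub>R \<gamma>)
        = (1 + t * g + (1 - s + t) * t * \<kappa>) *\<^sub>R w"
    proof -
      have "\<beta> = (1 - s) *\<^sub>R p - w" by (simp add: w_def)
      then show ?thesis by (simp only: \<gamma>_def q_def) (simp add: algebra_simps)
    qed
    also have "1 + t * g + (1 - s + t) * t * \<kappa> = (N * t\<^sup>2 + h * t + F) / F"
      using F0 by (simp add: h_def \<kappa>_def field_simps power2_eq_square)
    finally show ?thesis unfolding eq_sigma_map_iff s' using t by simp
  qed
  obtain tm tp where t: "tm < 0" "0 < tp"
    "N * tm\<^sup>2 + h * tm + F = 0" "N * tp\<^sup>2 + h * tp + F = 0"
    using quadratic_roots_opposite_signs[OF N0 F0] by blast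
  (* rescale so that q becomes a unit vector *)
  show ?thesis
  proof (intro exI conjI)
    show "norm ((1 / norm q) *\<^sub>R q) = 1" using q0 by simp
    show "((1 / norm q) *\<^sub>R \<gamma>) \<bullet> ((1 / norm q) *\<^sub>R q) = 0" by (simp add: gq)
    show "norm q * tm < 0" "0 < norm q * tp" using t q0 by (simp_all add: mult_pos_neg)
    show "\<beta> + (norm q * tm) *\<^sub>R ((1 / norm q) *\<^sub>R \<gamma>)
        = sigma_map (p + (norm q * tm) *\<^sub>R ((1 / norm q) *\<^sub>R q))"
      using root[OF t(3)] q0 by simp
    show "\<beta> + (norm q * tp) *\<^sub>R ((1 / norm q) *\<^sub>R \<gamma>)
        = sigma_map (p + (norm q * tp) *\<^sub>R ((1 / norm q) *\<^sub>R q))"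
      using root[OF t(4)] q0 by simp
  qed
qed

lemma block_split_in_K0:
  assumes "trace B = 0" "defect p \<beta> < 0" "\<epsilon> > 0"
  shows "\<exists>q \<gamma> b \<eta> tm tp.
    \<eta> = block q b ((1 / b) *\<^sub>R tensor \<gamma> q) \<gamma> \<and> rank \<eta> = 1 \<and>
    norm q = 1 \<and> \<gamma> \<bullet> q = 0 \<and> b \<noteq> 0 \<and> \<bar>b\<bar> < \<epsilon> \<and> tm < 0 \<and> 0 < tp \<and>
    block p c B \<beta> + tm *\<^sub>R \<eta> \<in> K0 \<and> block p c B \<beta> + tp *\<^sub>R \<eta> \<in> K0"
proof -
  obtain q \<gamma> tm tp where q: "norm q = 1" "\<gamma> \<bullet> q = 0" and t: "tm < 0" "0 < tp"
    and m: "\<beta> + tm *\<^sub>R \<gamma> = sigma_map (p + tm *\<^sub>R q)"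
    and p: "\<beta> + tp *\<^sub>R \<gamma> = sigma_map (p + tp *\<^sub>R q)"
    using defect_neg_split[OF assms(2)] by blast
  define b where "b = \<epsilon> / 2"
  have b: "b \<noteq> 0" "\<bar>b\<bar> < \<epsilon>" using assms(3) by (auto simp: b_def)
  define \<eta> where "\<eta> = block q b ((1 / b) *\<^sub>R tensor \<gamma> q) \<gamma>"
  have "q \<noteq> 0" using q(1) by auto
  then have "rank \<eta> = 1" unfolding \<eta>_def using b(1) by (rule rank_block_eq_1)
  moreover have "block p c B \<beta> + tm *\<^sub>R \<eta> \<in> K0" "block p c B \<beta> + tp *\<^sub>R \<eta> \<in> K0"
    using m p q(2) assms(1)
    by (simp_all add: \<eta>_def block_scaleR block_add block_in_K0_iff trace_add trace_scaleR
        trace_tensor)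
  ultimately show ?thesis using q t b \<eta>_def by blast
qed

section \<open>The set \<open>L(K\<^sub>0)\<close>\<close>

lemma L_set_K0_subset:
  assumes "\<xi> \<in> L_set K0"
  shows "\<exists>p c B \<beta>. \<xi> = block p c B \<beta> \<and> trace B = 0 \<and> defect p \<beta> < 0"
proof -
  obtain \<mu> \<xi>1 \<xi>2 where \<xi>: "\<xi> \<notin> K0" "\<xi> = \<mu> *\<^sub>R \<xi>1 + (1 - \<mu>) *\<^sub>R \<xi>2" and \<mu>: "0 < \<mu>" "\<mu> < 1"
    and K: "\<xi>1 \<in> K0" "\<xi>2 \<in> K0" and r: "rank (\<xi>1 - \<xi>2) = 1"
    using assms unfolding L_set_def by auto
  obtain p1 c1 B1 p2 c2 B2 where
    x1: "\<xi>1 = block p1 c1 B1 (sigma_map p1)" "trace B1 = 0" and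
    x2: "\<xi>2 = block p2 c2 B2 (sigma_map p2)" "trace B2 = 0"
    using K unfolding K0_def by auto
  have orth: "(p1 - p2) \<bullet> (sigma_map p1 - sigma_map p2) = 0"
    using r x1 x2 by (auto simp: block_diff trace_sub intro: rank_1_block_inner)
  define p where "p = \<mu> *\<^sub>R p1 + (1 - \<mu>) *\<^sub>R p2"
  define \<beta> where "\<beta> = \<mu> *\<^sub>R sigma_map p1 + (1 - \<mu>) *\<^sub>R sigma_map p2"
  define B where "B = \<mu> *\<^sub>R B1 + (1 - \<mu>) *\<^sub>R B2"
  have blk: "\<xi> = block p (\<mu> * c1 + (1 - \<mu>) * c2) B \<beta>"
    by (simp add: \<xi>(2) x1 x2 block_scaleR block_add p_def \<beta>_def B_def)
  have tr: "trace B = 0" by (simp add: B_def trace_add trace_scaleR x1 x2)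
  (* p1 = p2 would also give equal last columns and put \<xi> itself into K0 *)
  have "p1 \<noteq> p2"
  proof
    assume "p1 = p2"
    then have "p = p1" "\<beta> = sigma_map p1"
      by (simp_all add: p_def \<beta>_def flip: scaleR_add_left)
    then show False using \<xi>(1) blk tr by (simp add: block_in_K0_iff)
  qed
  then have "defect p \<beta> < 0"
    unfolding p_def \<beta>_def using orth \<mu> by (rule defect_neg_between)
  then show ?thesis using blk tr by blast
qed

lemma block_in_L_set_K0:
  assumes "trace B = 0" "defect p \<beta> < 0"
  shows "block p c B \<beta> \<in> L_set K0"
proof -
  let ?\<xi> = "block p c B \<beta>"
  obtain \<eta> tm tp where \<eta>: "rank \<eta> = 1" and t: "tm < 0" "0 < tp"
    and K: "?\<xi> + tm *\<^sub>R \<eta> \<in> K0" "?\<xi> + tp *\<^sub>R \<eta> \<in> K0"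
    using block_split_in_K0[OF assms zero_less_one, of c] by blast
  define \<mu> where "\<mu> = tp / (tp - tm)"
  have \<mu>: "\<mu> \<in> {0<..<1}" using t by (auto simp: \<mu>_def field_simps)
  have "\<mu> * tm + (1 - \<mu>) * tp = 0" using t by (simp add: \<mu>_def field_simps)
  moreover have "\<mu> *\<^sub>R (?\<xi> + tm *\<^sub>R \<eta>) + (1 - \<mu>) *\<^sub>R (?\<xi> + tp *\<^sub>R \<eta>)
      = ?\<xi> + (\<mu> * tm + (1 - \<mu>) * tp) *\<^sub>R \<eta>"
    by (simp add: algebra_simps)
  ultimately have comb: "?\<xi> = \<mu> *\<^sub>R (?\<xi> + tm *\<^sub>R \<eta>) + (1 - \<mu>) *\<^sub>R (?\<xi> + tp *\<^sub>R \<eta>)"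
    by simp
  have "(?\<xi> + tm *\<^sub>R \<eta>) - (?\<xi> + tp *\<^sub>R \<eta>) = (tm - tp) *\<^sub>R \<eta>" by (simp add: algebra_simps)
  then have "rank ((?\<xi> + tm *\<^sub>R \<eta>) - (?\<xi> + tp *\<^sub>R \<eta>)) = 1"
    using rank_eq_1_scaleR[OF \<eta>, of "tm - tp"] t by simp
  moreover have "?\<xi> \<notin> K0"
    using assms(2) defect_sigma_map[of p] by (auto simp: block_in_K0_iff)
  ultimately show ?thesis unfolding L_set_def using \<mu> K comb by blast
qed

theorem theorem4p1:
  "L_set (K0 :: ('n::finite) block_matrix set) =
     {block p c B \<beta> | p c B \<beta>.
        trace B = 0 \<and> (norm \<beta>)\<^sup>2 + (p \<bullet> \<beta>)\<^sup>2 - p \<bullet> \<beta> < 0}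
   \<and> (\<forall>\<xi> \<in> L_set (K0 :: 'n block_matrix set). \<forall>\<epsilon>::real. \<epsilon> > 0 \<longrightarrow>
        (\<exists>(q :: real ^ 'n) (\<gamma> :: real ^ 'n) (b::real) (\<eta> :: 'n block_matrix) (t\<^sub>m::real) (t\<^sub>p::real).
           \<eta> = block q b ((1 / b) *\<^sub>R tensor \<gamma> q) \<gamma> \<and> rank \<eta> = 1 \<and>
           norm q = 1 \<and> \<gamma> \<bullet> q = 0 \<and> b \<noteq> 0 \<and> \<bar>b\<bar> < \<epsilon> \<and>
           t\<^sub>m < 0 \<and> 0 < t\<^sub>p \<and>
           \<xi> + t\<^sub>m *\<^sub>R \<eta> \<in> K0 \<and> \<xi> + t\<^sub>p *\<^sub>R \<eta> \<in> K0))"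
proof (intro conjI ballI allI impI)
  show "L_set (K0 :: 'n block_matrix set) =
     {block p c B \<beta> | p c B \<beta>.
        trace B = 0 \<and> (norm \<beta>)\<^sup>2 + (p \<bullet> \<beta>)\<^sup>2 - p \<bullet> \<beta> < 0}"
    unfolding defect_def[symmetric]
    using L_set_K0_subset block_in_L_set_K0 by blast
next
  fix \<xi> :: "'n block_matrix" and \<epsilon> :: real
  assume "\<xi> \<in> L_set K0" and \<epsilon>: "\<epsilon> > 0"
  then obtain p c B \<beta> where \<xi>: "\<xi> = block p c B \<beta>" and B: "trace B = 0" "defect p \<beta> < 0"
    using L_set_K0_subset by blast
  show "\<exists>(q :: real ^ 'n) (\<gamma> :: real ^ 'n) (b::real) (\<eta> :: 'n block_matrix) (t\<^sub>m::real) (t\<^sub>p::real).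
           \<eta> = block q b ((1 / b) *\<^sub>R tensor \<gamma> q) \<gamma> \<and> rank \<eta> = 1 \<and>
           norm q = 1 \<and> \<gamma> \<bullet> q = 0 \<and> b \<noteq> 0 \<and> \<bar>b\<bar> < \<epsilon> \<and>
           t\<^sub>m < 0 \<and> 0 < t\<^sub>p \<and>
           \<xi> + t\<^sub>m *\<^sub>R \<eta> \<in> K0 \<and> \<xi> + t\<^sub>p *\<^sub>R \<eta> \<in> K0"
    unfolding \<xi> by (rule block_split_in_K0[OF B \<epsilon>])
qed

end
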